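(* Let $\mathcal{A}$ be a unital (complex) Banach algebra, let $\mathcal{X}$ be a bounded, Banach $\mathcal{A}$-bimodule, let $\mathcal{G}$ denote the connected component of the identity in the group of invertible elements of $\mathcal{A}$, and let $\mathcal{L}$ be a closed linear subspace of $\mathcal{X}$. Then $\mathcal{L}$ is a Lie subspace over $\mathcal{A}$ if, and only if, $b^{-1}\mathcal{L}b \subseteq \mathcal{L}$ for every $b \in \mathcal{G}$.
   Context: A Banach space $\mathcal{X}$ is a bounded, Banach $\mathcal{A}$-bimodule if it is an $\mathcal{A}$-bimodule such that the identity element of $\mathcal{A}$ acts as the identity on $\mathcal{X}$ (on both sides) and there is a constant $K$ with $\|axb\| \le K\|a\|\,\|x\|\,\|b\|$ for all $a,b \in \mathcal{A}$, $x \in \mathcal{X}$. A linear subspace $\mathcal{L} \subseteq \mathcal{X}$ (not necessarily a submodule) is a Lie subspace over $\mathcal{A}$ if $ax - xa \in \mathcal{L}$ for every $x \in \mathcal{L}$ and every $a \in \mathcal{A}$. The group of invertible elements carries the norm topology. *)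

theory Defs
  imports "HOL-Analysis.Analysis"
begin

class complex_vector = real_vector +
  fixes scaleC :: "complex \<Rightarrow> 'a \<Rightarrow> 'a"  (infixr \<open>*\<^sub>C\<close> 75)
  assumes scaleC_add_right: "z *\<^sub>C (x + y) = z *\<^sub>C x + z *\<^sub>C y"
    and scaleC_add_left: "(z + w) *\<^sub>C x = z *\<^sub>C x + w *\<^sub>C x"
    and scaleC_scaleC: "z *\<^sub>C (w *\<^sub>C x) = (z * w) *\<^sub>C x"
    and scaleC_one: "1 *\<^sub>C x = x"
    and scaleR_scaleC: "r *\<^sub>R x = complex_of_real r *\<^sub>C x"

class complex_banach = complex_vector + banach +
  assumes norm_scaleC: "norm (z *\<^sub>C x) = cmod z * norm x"

text \<open>The norm is submultiplicative (from \<open>real_normed_algebra\<close>). The unit comes from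
  \<open>monoid_mult\<close>, so neither \<open>norm 1 = 1\<close> nor \<open>1 \<noteq> 0\<close> is required.\<close>

class complex_banach_algebra = complex_banach + real_normed_algebra + monoid_mult +
  assumes mult_scaleC_left: "(z *\<^sub>C a) * b = z *\<^sub>C (a * b)"
    and mult_scaleC_right: "a * (z *\<^sub>C b) = z *\<^sub>C (a * b)"

global_interpretation complex_vector:
  vector_space "scaleC :: complex \<Rightarrow> 'a \<Rightarrow> 'a::complex_vector"
  defines csubspace = complex_vector.subspace
  by unfold_locales
    (simp_all add: scaleC_add_right scaleC_add_left scaleC_scaleC scaleC_one)

definition invertibles :: "'a::monoid_mult set" where
  "invertibles = {a. \<exists>c. a * c = 1 \<and> c * a = 1}"

definition mult_inverse :: "'a::monoid_mult \<Rightarrow> 'a" where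
  "mult_inverse a = (THE c. a * c = 1 \<and> c * a = 1)"

lemma mult_inverse:
  assumes "a \<in> invertibles"
  shows "a * mult_inverse a = 1" "mult_inverse a * a = 1"
proof -
  obtain c where c: "a * c = 1" "c * a = 1"
    using assms by (auto simp: invertibles_def)
  have "d = c" if "a * d = 1" "d * a = 1" for d
  proof -
    have "d = (c * a) * d" by (simp add: c)
    also have "\<dots> = c" by (simp only: mult.assoc that mult_1_right)
    finally show ?thesis .
  qed
  then have "mult_inverse a = c"
    unfolding mult_inverse_def using c by (intro the_equality) blast+
  with c show "a * mult_inverse a = 1" "mult_inverse a * a = 1" by simp_all
qed

text \<open>\<open>connected_component_set\<close> is taken in the subspace topology inherited from the norm.\<close>

definition identity_component :: "'a::complex_banach_algebra set" where
  "identity_component = connected_component_set invertibles 1"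

locale bounded_banach_bimodule =
  fixes lact :: "'a::complex_banach_algebra \<Rightarrow> 'x::complex_banach \<Rightarrow> 'x"  (infixr \<open>\<rhd>\<close> 75)
    and ract :: "'x \<Rightarrow> 'a \<Rightarrow> 'x"  (infixl \<open>\<lhd>\<close> 74)
  assumes lact_add_left: "(a + b) \<rhd> x = a \<rhd> x + b \<rhd> x"
    and lact_add_right: "a \<rhd> (x + y) = a \<rhd> x + a \<rhd> y"
    and lact_scaleC_left: "(z *\<^sub>C a) \<rhd> x = z *\<^sub>C (a \<rhd> x)"
    and lact_scaleC_right: "a \<rhd> (z *\<^sub>C x) = z *\<^sub>C (a \<rhd> x)"
    and ract_add_left: "(x + y) \<lhd> a = (x \<lhd> a) + (y \<lhd> a)"
    and ract_add_right: "x \<lhd> (a + b) = (x \<lhd> a) + (x \<lhd> b)"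
    and ract_scaleC_left: "(z *\<^sub>C x) \<lhd> a = z *\<^sub>C (x \<lhd> a)"
    and ract_scaleC_right: "x \<lhd> (z *\<^sub>C a) = z *\<^sub>C (x \<lhd> a)"
    and lact_mult: "(a * b) \<rhd> x = a \<rhd> (b \<rhd> x)"
    and ract_mult: "x \<lhd> (a * b) = (x \<lhd> a) \<lhd> b"
    and lact_ract: "(a \<rhd> x) \<lhd> b = a \<rhd> (x \<lhd> b)"
    and lact_one: "1 \<rhd> x = x"
    and ract_one: "x \<lhd> 1 = x"
    and bounded: "\<exists>K::real. \<forall>a x b. norm ((a \<rhd> x) \<lhd> b) \<le> K * norm a * norm x * norm b"

definition lie_subspace ::
  "('a::complex_banach_algebra \<Rightarrow> 'x::complex_banach \<Rightarrow> 'x) \<Rightarrow> ('x \<Rightarrow> 'a \<Rightarrow> 'x) \<Rightarrow> 'x set \<Rightarrow> bool"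
  where "lie_subspace lact ract L \<longleftrightarrow>
    csubspace L \<and> (\<forall>x\<in>L. \<forall>a. lact a x - ract x a \<in> L)"

end

theory Submission
  imports Defs
begin

text \<open>
  Write \<open>[a, x] = a x - x a\<close>. Both directions rest on the identity
  \<open>h\<inverse> x h - x = h\<inverse> [a, x]\<close> for \<open>h = 1 - a\<close>, with
  \<open>h\<inverse>\<close> given by the Neumann series when \<open>norm a < 1\<close>.

  If \<open>L\<close> is invariant under conjugation, apply the identity to \<open>h = 1 - t a\<close>, which lies in
  the identity component for small \<open>t > 0\<close>: it yields \<open>(1 - t a)\<inverse> [a, x] \<in> L\<close>
  after division by \<open>t\<close>, and letting \<open>t\<close> tend to 0 gives \<open>[a, x] \<in> L\<close>,
  because \<open>L\<close> is closed (\<open>conj_invariant_imp_commutator_mem\<close>).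

  Conversely, let \<open>L\<close> be a Lie subspace. Since \<open>L\<close> is closed, expanding \<open>h\<inverse>\<close> shows that
  \<open>h\<inverse> x h \<in> L\<close> as soon as every \<open>a\<^sup>n [a, x]\<close> lies in \<open>L\<close>. This is
  not obvious, since \<open>L\<close> need not be a submodule, but it is a purely algebraic fact that uses only
  division by positive integers (\<open>lie_subspace_power_commutator_power\<close>). It avoids writing \<open>h\<close>
  as an exponential. The same fact with powers on the right shows
  \<open>h x h\<inverse> \<in> L\<close>, so multiplying an invertible \<open>b\<close> by an \<open>h\<close> near 1 does not
  change whether \<open>b\<inverse> L b \<subseteq> L\<close>. Hence this property of \<open>b\<close> is locally constant on the
  invertibles, and as it holds at 1 it holds on the whole identity component
  (\<open>lie_subspace_imp_conj_invariant\<close>).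
\<close>

section \<open>Inverses and the Neumann series\<close>

lemma mult_inverse_eqI:
  fixes a c :: "'a::monoid_mult"
  assumes "a * c = 1" "c * a = 1"
  shows "a \<in> invertibles" "mult_inverse a = c"
proof -
  show inv: "a \<in> invertibles"
    using assms by (auto simp: invertibles_def)
  have "mult_inverse a = (c * a) * mult_inverse a"
    by (simp add: assms)
  also have "\<dots> = c"
    by (simp only: mult.assoc mult_inverse(1)[OF inv] mult_1_right)
  finally show "mult_inverse a = c" .
qed

lemma mult_inverse_mult:
  fixes a b :: "'a::monoid_mult"
  assumes "a \<in> invertibles" "b \<in> invertibles"
  shows "a * b \<in> invertibles" "mult_inverse (a * b) = mult_inverse b * mult_inverse a"
proof -
  have "(a * b) * (mult_inverse b * mult_inverse a) = a * (b * mult_inverse b) * mult_inverse a"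
    by (simp only: mult.assoc)
  then have 1: "(a * b) * (mult_inverse b * mult_inverse a) = 1"
    using assms by (simp add: mult_inverse)
  have "(mult_inverse b * mult_inverse a) * (a * b) = mult_inverse b * (mult_inverse a * a) * b"
    by (simp only: mult.assoc)
  then have 2: "(mult_inverse b * mult_inverse a) * (a * b) = 1"
    using assms by (simp add: mult_inverse)
  show "a * b \<in> invertibles" "mult_inverse (a * b) = mult_inverse b * mult_inverse a"
    using mult_inverse_eqI[OF 1 2] by auto
qed

text \<open>The unit may have norm other than 1, which costs a factor \<open>norm 1\<close> in the comparison with
  the geometric series.\<close>

lemma summable_power_Banach_algebra:
  fixes a :: "'a::{banach, real_normed_algebra, monoid_mult}"
  assumes "norm a < 1"
  shows "summable (\<lambda>n. a ^ n)"
proof (rule summable_comparison_test')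
  show "summable (\<lambda>n. norm (1::'a) * norm a ^ n)"
    using assms by (intro summable_mult summable_geometric) simp
  show "norm (a ^ n) \<le> norm (1::'a) * norm a ^ n" if "0 \<le> n" for n
  proof (induction n)
    case (Suc n)
    have "norm (a ^ Suc n) \<le> norm a * norm (a ^ n)"
      by (simp add: norm_mult_ineq)
    also have "\<dots> \<le> norm a * (norm (1::'a) * norm a ^ n)"
      using Suc by (intro mult_left_mono) auto
    finally show ?case by (simp add: mult_ac)
  qed simp
qed

lemma Neumann_series:
  fixes a :: "'a::{banach, real_normed_algebra, monoid_mult}"
  assumes "norm a < 1"
  shows "1 - a \<in> invertibles" "mult_inverse (1 - a) = (\<Sum>n. a ^ n)"
proof -
  let ?f = "\<lambda>n. a ^ n"
  have s: "summable ?f"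
    by (rule summable_power_Banach_algebra[OF assms])
  have split: "suminf ?f = 1 + (\<Sum>n. a ^ Suc n)"
    using suminf_split_head[OF s] by simp
  have "a * suminf ?f = (\<Sum>n. a ^ Suc n)"
    using bounded_linear.suminf[OF bounded_linear_mult_right s, of a] by simp
  with split have 1: "(1 - a) * suminf ?f = 1"
    by (simp add: algebra_simps)
  have "suminf ?f * a = (\<Sum>n. a ^ Suc n)"
    using bounded_linear.suminf[OF bounded_linear_mult_left s, of a]
    by (simp add: power_Suc2 del: power_Suc)
  with split have 2: "suminf ?f * (1 - a) = 1"
    by (simp add: algebra_simps)
  show "1 - a \<in> invertibles" "mult_inverse (1 - a) = suminf ?f"
    using mult_inverse_eqI[OF 1 2] by auto
qed

text \<open>A quantitative form of continuity of inversion at 1. With \<open>c = (1 - a)\<inverse>\<close> one has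
  \<open>c = 1 + a c\<close>; the hypothesis lets half of \<open>norm c\<close> absorb the last term, so that
  \<open>norm c \<le> 2 norm 1\<close>.\<close>

lemma norm_mult_inverse_one_minus:
  fixes a :: "'a::{banach, real_normed_algebra, monoid_mult}"
  assumes "norm a \<le> 1 / 2"
  shows "norm (mult_inverse (1 - a) - 1) \<le> 2 * norm (1::'a) * norm a"
proof -
  let ?c = "mult_inverse (1 - a)"
  have "?c - a * ?c = 1"
    using mult_inverse(1)[OF Neumann_series(1), of a] assms by (simp add: algebra_simps)
  then have diff: "?c - 1 = a * ?c"
    by (simp add: algebra_simps)
  have "norm ?c \<le> norm (1::'a) + norm (a * ?c)"
    using norm_triangle_ineq[of 1 "a * ?c"] diff by (metis add_diff_cancel_left' diff_add_cancel add.commute)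
  also have "norm (a * ?c) \<le> 1 / 2 * norm ?c"
    using assms by (intro order_trans[OF norm_mult_ineq] mult_right_mono) auto
  finally have "norm ?c \<le> 2 * norm (1::'a)" by simp
  then have "norm a * norm ?c \<le> norm a * (2 * norm (1::'a))"
    by (intro mult_left_mono) auto
  then show ?thesis
    using norm_mult_ineq[of a ?c] diff by (simp add: mult_ac)
qed

text \<open>The unit ball around 1 is convex, hence connected.\<close>

lemma ball_one_subset_identity_component:
  "ball 1 1 \<subseteq> (identity_component :: 'a::complex_banach_algebra set)"
  unfolding identity_component_def
proof (rule connected_component_maximal)
  show "ball 1 1 \<subseteq> (invertibles :: 'a set)"
  proof
    fix b :: 'a
    assume "b \<in> ball 1 1"
    then show "b \<in> invertibles"
      using Neumann_series(1)[of "1 - b"] by (simp add: dist_norm)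
  qed
qed auto

section \<open>Bounded bimodules and commutators\<close>

lemma csubspace_imp_subspace:
  fixes L :: "'x::complex_vector set"
  assumes "csubspace L"
  shows "subspace L"
  using assms
  by (auto simp: subspace_def scaleR_scaleC complex_vector.subspace_0
      complex_vector.subspace_add complex_vector.subspace_scale)

context bounded_banach_bimodule
begin

lemma lact_scaleR: "(r *\<^sub>R a) \<rhd> x = r *\<^sub>R (a \<rhd> x)" "a \<rhd> (r *\<^sub>R x) = r *\<^sub>R (a \<rhd> x)"
  by (simp_all add: scaleR_scaleC lact_scaleC_left lact_scaleC_right)

lemma ract_scaleR: "(r *\<^sub>R x) \<lhd> a = r *\<^sub>R (x \<lhd> a)" "x \<lhd> (r *\<^sub>R a) = r *\<^sub>R (x \<lhd> a)"
  by (simp_all add: scaleR_scaleC ract_scaleC_left ract_scaleC_right)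

text \<open>The bound on the two-sided action becomes one for each action by putting 1 on the other
  side.\<close>

lemma bounded_bilinear_lact: "bounded_bilinear lact"
proof
  obtain K where K: "norm (a \<rhd> x \<lhd> b) \<le> K * norm a * norm x * norm b" for a x b
    using bounded by blast
  have "norm (a \<rhd> x) \<le> norm a * norm x * (K * norm (1::'a))" for a x
    using K[of a x 1] by (simp add: ract_one mult_ac)
  then show "\<exists>K. \<forall>a x. norm (a \<rhd> x) \<le> norm a * norm x * K" by blast
qed (simp_all add: lact_add_left lact_add_right lact_scaleR)

lemma bounded_bilinear_ract: "bounded_bilinear ract"
proof
  obtain K where K: "norm (a \<rhd> x \<lhd> b) \<le> K * norm a * norm x * norm b" for a x b
    using bounded by blast
  have "norm (x \<lhd> a) \<le> norm x * norm a * (K * norm (1::'a))" for a x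
    using K[of 1 x a] by (simp add: lact_one mult_ac)
  then show "\<exists>K. \<forall>x a. norm (x \<lhd> a) \<le> norm x * norm a * K" by blast
qed (simp_all add: ract_add_left ract_add_right ract_scaleR)

lemmas lact_diff_left = bounded_bilinear.diff_left[OF bounded_bilinear_lact]
  and lact_diff_right = bounded_bilinear.diff_right[OF bounded_bilinear_lact]
  and ract_diff_left = bounded_bilinear.diff_left[OF bounded_bilinear_ract]
  and ract_diff_right = bounded_bilinear.diff_right[OF bounded_bilinear_ract]

definition commutator :: "'a \<Rightarrow> 'x \<Rightarrow> 'x" where
  "commutator a x = a \<rhd> x - x \<lhd> a"

section \<open>Power multiples of a commutator in a Lie subspace\<close>

text \<open>The module form of \<open>(s - r) (s\<^sup>m + s\<^sup>m\<^sup>-\<^sup>1 r + \<dots> + r\<^sup>m) = s\<^sup>m\<^sup>+\<^sup>1 - r\<^sup>m\<^sup>+\<^sup>1\<close>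
  for the commuting operators \<open>s\<close> and \<open>r\<close> of left and right multiplication by \<open>a\<close>.\<close>

lemma sum_power_commutator_power:
  "(\<Sum>i\<le>m. a ^ i \<rhd> commutator a x \<lhd> a ^ (m - i)) = commutator (a ^ Suc m) x"
proof -
  define f where "f i = a ^ i \<rhd> x \<lhd> a ^ (Suc m - i)" for i
  have "a ^ i \<rhd> commutator a x \<lhd> a ^ (m - i) = f (Suc i) - f i" if "i \<le> m" for i
  proof -
    have "a ^ i \<rhd> (a \<rhd> x) = a ^ Suc i \<rhd> x"
      by (simp add: lact_mult[symmetric] power_Suc2 del: power_Suc)
    moreover have "a ^ i \<rhd> (x \<lhd> a) \<lhd> a ^ (m - i) = a ^ i \<rhd> x \<lhd> a ^ (Suc m - i)"
      using that by (simp add: lact_ract[symmetric] ract_mult[symmetric] Suc_diff_le)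
    ultimately show ?thesis
      by (simp add: f_def commutator_def lact_diff_right ract_diff_left)
  qed
  then have "(\<Sum>i\<le>m. a ^ i \<rhd> commutator a x \<lhd> a ^ (m - i)) = (\<Sum>i<Suc m. f (Suc i) - f i)"
    by (simp add: lessThan_Suc_atMost)
  also have "\<dots> = f (Suc m) - f 0"
    by (rule sum_lessThan_telescope)
  finally show ?thesis
    by (simp add: f_def commutator_def lact_one ract_one)
qed

text \<open>Put \<open>w i j = a\<^sup>i [a, x] a\<^sup>j\<close> and argue by induction on the total degree \<open>i + j\<close>. If the
  terms of degree \<open>n\<close> lie in \<open>L\<close>, then so does \<open>[a, w i j] = w (i + 1) j - w i (j + 1)\<close> for
  \<open>i + j = n\<close>; thus all terms of degree \<open>n + 1\<close> agree modulo \<open>L\<close>. Their sum is the commutator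
  \<open>[a\<^sup>n\<^sup>+\<^sup>2, x] \<in> L\<close>, so that \<open>n + 2\<close> times any one of them lies in \<open>L\<close>.
  Powers on both sides are allowed because commuting \<open>a\<^sup>n [a, x]\<close> with \<open>a\<close> already
  produces mixed terms.\<close>

lemma lie_subspace_power_commutator_power:
  assumes "lie_subspace lact ract L" and "x \<in> L"
  shows "a ^ i \<rhd> commutator a x \<lhd> a ^ j \<in> L"
proof -
  have L: "subspace L"
    using assms by (auto simp: lie_subspace_def intro: csubspace_imp_subspace)
  have comm: "commutator b y \<in> L" if "y \<in> L" for b y
    using assms that by (simp add: lie_subspace_def commutator_def)
  define w where "w i j = a ^ i \<rhd> commutator a x \<lhd> a ^ j" for i j
  have "\<forall>i\<le>n. w i (n - i) \<in> L" for n
  proof (induction n)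
    case 0
    show ?case using comm[OF assms(2)] by (simp add: w_def lact_one ract_one)
  next
    case (Suc n)
    have shift: "w (Suc i) (n - i) - w i (Suc (n - i)) \<in> L" if "i \<le> n" for i
    proof -
      have "a \<rhd> w i (n - i) = w (Suc i) (n - i)"
        by (simp add: w_def lact_ract[symmetric] lact_mult[symmetric])
      moreover have "w i (n - i) \<lhd> a = w i (Suc (n - i))"
        by (simp add: w_def ract_mult[symmetric] power_Suc2 del: power_Suc)
      ultimately have "commutator a (w i (n - i)) = w (Suc i) (n - i) - w i (Suc (n - i))"
        by (simp only: commutator_def)
      then show ?thesis using comm Suc that by metis
    qed
    have congruent: "w i (Suc n - i) - w 0 (Suc n) \<in> L" if "i \<le> Suc n" for i
      using that
    proof (induction i)
      case 0
      show ?case using L by (simp add: subspace_0)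
    next
      case (Suc i)
      then have "w i (Suc (n - i)) - w 0 (Suc n) \<in> L"
        by (simp add: Suc_diff_le)
      from subspace_add[OF L shift[of i] this] Suc.prems show ?case by simp
    qed
    have "(\<Sum>i\<le>Suc n. w i (Suc n - i)) \<in> L"
      unfolding w_def sum_power_commutator_power by (rule comm[OF assms(2)])
    moreover have "(\<Sum>i\<le>Suc n. w i (Suc n - i) - w 0 (Suc n)) \<in> L"
      using congruent by (intro subspace_sum[OF L]) auto
    ultimately have "(\<Sum>i\<le>Suc n. w i (Suc n - i)) - (\<Sum>i\<le>Suc n. w i (Suc n - i) - w 0 (Suc n)) \<in> L"
      by (rule subspace_diff[OF L])
    then have "real (n + 2) *\<^sub>R w 0 (Suc n) \<in> L"
      by (simp only: sum_subtractf sum_constant_scaleR) simp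
    then have "inverse (real (n + 2)) *\<^sub>R (real (n + 2) *\<^sub>R w 0 (Suc n)) \<in> L"
      by (rule subspace_scale[OF L])
    then have w0: "w 0 (Suc n) \<in> L" by simp
    show ?case
      using subspace_add[OF L congruent w0] by auto
  qed
  from this[rule_format, of i "i + j"] show ?thesis by (simp add: w_def)
qed

section \<open>Conjugation by invertible elements\<close>

text \<open>With \<open>h = 1 - a\<close> one has \<open>h\<inverse> x h = x + h\<inverse> [a, x]\<close> and
  \<open>h x h\<inverse> = x - [a, x] h\<inverse>\<close>, and the Neumann series turns the two correction terms into
  limits of elements of \<open>L\<close>.\<close>

lemma lie_subspace_conjugate_near_one:
  assumes lie: "lie_subspace lact ract L" and "closed L" and "x \<in> L" and "norm a < 1"
  shows "mult_inverse (1 - a) \<rhd> x \<lhd> (1 - a) \<in> L"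
    and "(1 - a) \<rhd> x \<lhd> mult_inverse (1 - a) \<in> L"
proof -
  let ?h = "1 - a" and ?c = "mult_inverse (1 - a)"
  have L: "subspace L"
    using lie by (auto simp: lie_subspace_def intro: csubspace_imp_subspace)
  have inv: "?h \<in> invertibles" and c: "?c = (\<Sum>n. a ^ n)"
    using Neumann_series assms(4) by auto
  have sums: "(\<lambda>n. a ^ n) sums ?c"
    unfolding c by (rule summable_sums[OF summable_power_Banach_algebra[OF assms(4)]])
  have sum_mem: "s \<in> L" if "f sums s" "\<And>n. f n \<in> L" for f s
    by (rule closed_sequentially[OF assms(2) _ that(1)[unfolded sums_def]])
       (use that(2) in \<open>auto intro: subspace_sum[OF L]\<close>)
  have "(\<lambda>n. a ^ n \<rhd> commutator a x) sums (?c \<rhd> commutator a x)"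
    by (rule bounded_linear.sums[OF bounded_bilinear.bounded_linear_left[OF bounded_bilinear_lact] sums])
  moreover have "a ^ n \<rhd> commutator a x \<in> L" for n
    using lie_subspace_power_commutator_power[OF lie assms(3), of a n 0] by (simp add: ract_one)
  ultimately have left: "?c \<rhd> commutator a x \<in> L"
    by (rule sum_mem)
  have "(\<lambda>n. commutator a x \<lhd> a ^ n) sums (commutator a x \<lhd> ?c)"
    by (rule bounded_linear.sums[OF bounded_bilinear.bounded_linear_right[OF bounded_bilinear_ract] sums])
  moreover have "commutator a x \<lhd> a ^ n \<in> L" for n
    using lie_subspace_power_commutator_power[OF lie assms(3), of a 0 n] by (simp add: lact_one)
  ultimately have right: "commutator a x \<lhd> ?c \<in> L"
    by (rule sum_mem)
  have comm: "commutator a x = x \<lhd> ?h - ?h \<rhd> x"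
    by (simp add: commutator_def lact_diff_left ract_diff_right lact_one ract_one)
  have "?c \<rhd> commutator a x = ?c \<rhd> x \<lhd> ?h - x"
    unfolding comm lact_diff_right
    by (simp add: lact_ract lact_mult[symmetric] mult_inverse[OF inv] lact_one)
  with subspace_add[OF L left assms(3)] show "?c \<rhd> x \<lhd> ?h \<in> L" by simp
  have "commutator a x \<lhd> ?c = x - ?h \<rhd> x \<lhd> ?c"
    unfolding comm ract_diff_left
    by (simp add: ract_mult[symmetric] mult_inverse[OF inv] ract_one)
  with subspace_diff[OF L assms(3) right] show "?h \<rhd> x \<lhd> ?c \<in> L" by simp
qed

definition conj_invariant :: "'x set \<Rightarrow> 'a \<Rightarrow> bool" where
  "conj_invariant L b \<longleftrightarrow> (\<forall>x\<in>L. mult_inverse b \<rhd> x \<lhd> b \<in> L)"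

text \<open>Write \<open>b' = b h\<close>, where the hypothesis puts \<open>h\<close> near 1. The elements
  \<open>b\<inverse> x b\<close> and \<open>b'\<inverse> x b'\<close> are carried to each other by conjugation with \<open>h\<close> and its
  inverse, both of which preserve \<open>L\<close>.\<close>

lemma lie_subspace_conj_invariant_locally_constant:
  assumes lie: "lie_subspace lact ract L" and "closed L"
    and b: "b \<in> invertibles" and near: "norm (mult_inverse b) * norm (b - b') < 1"
  shows "b' \<in> invertibles" "conj_invariant L b' \<longleftrightarrow> conj_invariant L b"
proof -
  let ?a = "mult_inverse b * (b - b')"
  let ?h = "1 - ?a" and ?c = "mult_inverse (1 - ?a)"
  have a: "norm ?a < 1"
    using near by (rule le_less_trans[OF norm_mult_ineq])
  have h: "?h \<in> invertibles"
    by (rule Neumann_series(1)[OF a])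
  have "?h = mult_inverse b * b'"
    by (simp add: right_diff_distrib mult_inverse[OF b])
  then have b': "b' = b * ?h"
    by (simp add: mult.assoc[symmetric] mult_inverse[OF b])
  then show "b' \<in> invertibles"
    using mult_inverse_mult(1)[OF b h] by simp
  have conj: "mult_inverse b' \<rhd> x \<lhd> b' = ?c \<rhd> (mult_inverse b \<rhd> x \<lhd> b) \<lhd> ?h" for x
    by (subst (1 2) b') (simp only: mult_inverse_mult(2)[OF b h] lact_mult ract_mult lact_ract)
  have "?h \<rhd> (mult_inverse b' \<rhd> x \<lhd> b') \<lhd> ?c
      = (?h * ?c) \<rhd> (mult_inverse b \<rhd> x \<lhd> b) \<lhd> (?h * ?c)" for x
    unfolding conj by (simp only: lact_mult ract_mult lact_ract)
  then have unconj: "?h \<rhd> (mult_inverse b' \<rhd> x \<lhd> b') \<lhd> ?c = mult_inverse b \<rhd> x \<lhd> b" for x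
    by (simp add: mult_inverse[OF h] lact_one ract_one)
  note near_one = lie_subspace_conjugate_near_one[OF lie assms(2) _ a]
  show "conj_invariant L b' \<longleftrightarrow> conj_invariant L b"
    unfolding conj_invariant_def using conj unconj near_one by metis
qed

text \<open>Local constancy splits the invertibles into two disjoint open sets; the connected identity
  component meets only the one containing 1.\<close>

lemma lie_subspace_imp_conj_invariant:
  assumes lie: "lie_subspace lact ract L" and "closed L" and b: "b \<in> identity_component"
  shows "conj_invariant L b"
proof -
  let ?S = "{b \<in> invertibles. conj_invariant L b}"
  let ?T = "{b \<in> invertibles. \<not> conj_invariant L b}"
  have near: "\<exists>e>0. \<forall>b'\<in>ball b e. b' \<in> invertibles \<and> (conj_invariant L b' \<longleftrightarrow> conj_invariant L b)"
    if "b \<in> invertibles" for b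
  proof (intro exI conjI ballI)
    \<comment> \<open>Adding 1 keeps the denominator positive even in the trivial algebra.\<close>
    let ?e = "1 / (norm (mult_inverse b) + 1)"
    show "?e > 0" by (simp add: add_nonneg_pos)
    fix b' assume "b' \<in> ball b ?e"
    then have "norm (b - b') * (norm (mult_inverse b) + 1) < 1"
      by (simp add: dist_norm pos_less_divide_eq add_nonneg_pos)
    then have "norm (mult_inverse b) * norm (b - b') < 1"
      using norm_ge_zero[of "b - b'"] unfolding distrib_left mult_1_right
      by (simp only: mult.commute[of "norm (b - b')"])
    from lie_subspace_conj_invariant_locally_constant[OF lie assms(2) that this]
    show "b' \<in> invertibles" "conj_invariant L b' \<longleftrightarrow> conj_invariant L b" .
  qed
  have open_S: "open ?S" and open_T: "open ?T"
    unfolding open_contains_ball using near by (auto simp: subset_eq) metis+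
  have "1 \<in> (invertibles :: 'a set)" "mult_inverse (1::'a) = 1"
    using mult_inverse_eqI[of 1 "1::'a"] by auto
  then have "1 \<in> ?S"
    by (simp add: conj_invariant_def lact_one ract_one)
  moreover have "1 \<in> (identity_component :: 'a set)"
    using ball_one_subset_identity_component by auto
  moreover have "identity_component \<subseteq> ?S \<union> ?T"
    using connected_component_subset[of invertibles 1] by (auto simp: identity_component_def)
  moreover have "connected (identity_component :: 'a set)"
    by (simp add: identity_component_def)
  ultimately have "?T \<inter> identity_component = {}"
    using connectedD[of identity_component ?S ?T] open_S open_T by blast
  with b \<open>identity_component \<subseteq> ?S \<union> ?T\<close> show ?thesis by blast
qed

text \<open>Differentiates the conjugation at 1 along the straight path \<open>1 - t a\<close>. The difference
  quotient of \<open>(1 - t a)\<inverse> x (1 - t a)\<close> is exactly \<open>(1 - t a)\<inverse> [a, x]\<close>, so only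
  continuity of inversion at 1 is needed.\<close>

lemma conj_invariant_imp_commutator_mem:
  assumes L: "subspace L" and "closed L"
    and inv: "\<And>b. b \<in> identity_component \<Longrightarrow> conj_invariant L b" and x: "x \<in> L"
  shows "commutator a x \<in> L"
proof -
  let ?c = "\<lambda>t::real. mult_inverse (1 - t *\<^sub>R a)"
  \<comment> \<open>For such \<open>t\<close> the norm of \<open>t a\<close> is at most 1/2, as the estimate for the inverse requires.\<close>
  let ?e = "1 / (2 * (norm a + 1))"
  have e: "?e > 0" by (simp add: add_nonneg_pos)
  have small: "norm (t *\<^sub>R a) \<le> 1 / 2" if "0 < t" "t < ?e" for t
  proof -
    have "t * (2 * (norm a + 1)) < 1"
      using that by (simp add: pos_less_divide_eq add_nonneg_pos)
    then show ?thesis using that by (simp add: algebra_simps)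
  qed
  have ev: "eventually (\<lambda>t. 0 < t \<and> t < ?e) (at_right 0)"
    using e unfolding eventually_at_right_field by blast
  have mem: "?c t \<rhd> commutator a x \<in> L" if t: "0 < t" "t < ?e" for t
  proof -
    let ?h = "1 - t *\<^sub>R a"
    have n: "norm (t *\<^sub>R a) < 1" using small[OF t] by simp
    have "?h \<in> identity_component"
      using ball_one_subset_identity_component n by (auto simp: dist_norm)
    then have "?c t \<rhd> x \<lhd> ?h \<in> L"
      using inv x by (simp add: conj_invariant_def)
    then have diff: "?c t \<rhd> x \<lhd> ?h - x \<in> L"
      by (rule subspace_diff[OF L _ x])
    have "x = ?c t \<rhd> (?h \<rhd> x)"
      by (simp add: lact_mult[symmetric] mult_inverse[OF Neumann_series(1)[OF n]] lact_one)
    then have "?c t \<rhd> x \<lhd> ?h - x = ?c t \<rhd> (x \<lhd> ?h - ?h \<rhd> x)"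
      by (simp only: lact_diff_right lact_ract)
    also have "x \<lhd> ?h - ?h \<rhd> x = t *\<^sub>R commutator a x"
      by (simp add: lact_diff_left ract_diff_right lact_one ract_one lact_scaleR ract_scaleR
          commutator_def scaleR_diff_right)
    finally have "t *\<^sub>R (?c t \<rhd> commutator a x) \<in> L"
      using diff by (simp add: lact_scaleR)
    from subspace_scale[OF L this, of "inverse t"] show ?thesis using t by simp
  qed
  have "((\<lambda>t. ?c t - 1) \<longlongrightarrow> 0) (at_right 0)"
  proof (rule Lim_null_comparison)
    show "eventually (\<lambda>t. norm (?c t - 1) \<le> 2 * norm (1::'a) * norm (t *\<^sub>R a)) (at_right 0)"
      using ev by eventually_elim (intro norm_mult_inverse_one_minus small, auto)
    show "((\<lambda>t. 2 * norm (1::'a) * norm (t *\<^sub>R a)) \<longlongrightarrow> 0) (at_right 0)"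
      by (rule tendsto_eq_rhs, (rule tendsto_intros)+) simp
  qed
  then have "(?c \<longlongrightarrow> 1) (at_right 0)"
    by (rule LIM_zero_cancel)
  then have "((\<lambda>t. ?c t \<rhd> commutator a x) \<longlongrightarrow> 1 \<rhd> commutator a x) (at_right 0)"
    by (intro bounded_bilinear.tendsto[OF bounded_bilinear_lact] tendsto_const)
  moreover have "eventually (\<lambda>t. ?c t \<rhd> commutator a x \<in> L) (at_right 0)"
    using ev by eventually_elim (simp add: mem)
  ultimately show ?thesis
    using Lim_in_closed_set[OF assms(2) _ trivial_limit_at_right_real] by (simp add: lact_one)
qed

end

theorem theorem1:
  fixes lact :: "'a::complex_banach_algebra \<Rightarrow> 'x::complex_banach \<Rightarrow> 'x"
    and ract :: "'x \<Rightarrow> 'a \<Rightarrow> 'x"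
    and L :: "'x set"
  assumes "bounded_banach_bimodule lact ract"
    and "csubspace L"
    and "closed L"
  shows "lie_subspace lact ract L \<longleftrightarrow>
    (\<forall>b \<in> (identity_component :: 'a set).
      (\<lambda>x. ract (lact (mult_inverse b) x) b) ` L \<subseteq> L)"
proof -
  interpret bounded_banach_bimodule lact ract by fact
  have "lie_subspace lact ract L \<longleftrightarrow> (\<forall>b \<in> identity_component. conj_invariant L b)"
    using lie_subspace_imp_conj_invariant[OF _ assms(3)]
      conj_invariant_imp_commutator_mem[OF csubspace_imp_subspace[OF assms(2)] assms(3)] assms(2)
    by (auto simp: lie_subspace_def commutator_def)
  then show ?thesis
    by (simp add: conj_invariant_def image_subset_iff)
qed

end
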